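(* For every triangle $T$ in the plane and every positive integer $k$, $$\delta_T^k(T)=\delta_L^k(T)=\frac{2k^2}{2k+1}.$$
   Context: A triangle is a closed nondegenerate triangle in $\mathbb{R}^2$; $|S|$ denotes area. Let $I=[0,1)$, so $lI^2=[0,l)^2$ for $l>0$. For a connected set $D\subset\mathbb{R}^2$, a family (repetitions allowed) of bounded sets $\{S_1,S_2,\ldots\}$ is a $k$-fold packing of $D$ if $\bigcup S_i\subset D$ and each point of $D$ belongs to the interiors of at most $k$ sets of the family (counted with multiplicity). If all $S_i$ are translates of a fixed bounded measurable set $S$, it is a $k$-fold translative packing of $D$ with $S$. If in addition the translation vectors form a lattice, it is a $k$-fold lattice packing of $D$ with $S$. Let $M(S,k,l)$ be the maximum number of sets in a $k$-fold translative packing of $lI^2$ with $S$. The $k$-fold translative packing density is $$\delta_T^k(S)=\limsup_{l\to\infty}\frac{M(S,k,l)\,|S|}{|lI^2|}.$$ (The subscript $T$ in $\delta_T^k$ stands for "translative" and is unrelated to the triangle $T$.) The $k$-fold lattice packing density $\delta_L^k(S)$ is the supremum of $|S|/\det\Lambda$ over all lattices $\Lambda\subset\mathbb{R}^2$ (of rank 2) such that $\{S+\lambda:\lambda\in\Lambda\}$ is a $k$-fold packing of $\mathbb{R}^2$, where $\det\Lambda$ is the area of a fundamental parallelogram of $\Lambda$. *)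

theory Defs
  imports "HOL-Analysis.Analysis"
begin

definition is_triangle :: "(real^2) set \<Rightarrow> bool" where
  "is_triangle T \<longleftrightarrow> (\<exists>a b c. \<not> collinear {a, b, c} \<and> T = convex hull {a, b, c})"

definition halfopen_square :: "real \<Rightarrow> (real^2) set" where
  "halfopen_square l = {x. \<forall>i. 0 \<le> x $ i \<and> x $ i < l}"

text \<open>A family with repetitions is a function on an index set; the index set is what the
  multiplicity is counted over. The finiteness clause is needed since \<^const>\<open>card\<close> is 0 on
  infinite sets.\<close>

definition kfold_packing :: "nat \<Rightarrow> (real^2) set \<Rightarrow> 'i set \<Rightarrow> ('i \<Rightarrow> (real^2) set) \<Rightarrow> bool" where
  "kfold_packing k D J F \<longleftrightarrow>
     connected D \<and> (\<forall>i\<in>J. bounded (F i)) \<and> (\<Union>i\<in>J. F i) \<subseteq> D \<and>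
     (\<forall>x\<in>D. finite {i\<in>J. x \<in> interior (F i)} \<and> card {i\<in>J. x \<in> interior (F i)} \<le> k)"

definition kfold_translative_packing ::
    "nat \<Rightarrow> (real^2) set \<Rightarrow> (real^2) set \<Rightarrow> 'i set \<Rightarrow> ('i \<Rightarrow> real^2) \<Rightarrow> bool" where
  "kfold_translative_packing k D S J t \<longleftrightarrow>
     bounded S \<and> S \<in> sets lebesgue \<and> kfold_packing k D J (\<lambda>i. (+) (t i) ` S)"

text \<open>The supremum in \<^typ>\<open>enat\<close> over the sizes of finite packings. It is a maximum whenever it
  is finite, in particular if \<open>S\<close> has nonempty interior; any infinite packing contains
  arbitrarily large finite ones.\<close>

definition max_packing_number :: "(real^2) set \<Rightarrow> nat \<Rightarrow> real \<Rightarrow> enat" where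
  "max_packing_number S k l =
     Sup {enat n | n. \<exists>t :: nat \<Rightarrow> real^2.
            kfold_translative_packing k (halfopen_square l) S {..<n} t}"

definition translative_packing_density :: "nat \<Rightarrow> (real^2) set \<Rightarrow> ereal" where
  "translative_packing_density k S =
     Limsup at_top (\<lambda>l :: real.
       ereal_of_enat (max_packing_number S k l) * ereal (measure lebesgue S)
         / ereal (measure lebesgue (halfopen_square l)))"

text \<open>The disequality is not redundant: \<^term>\<open>{u, u}\<close> is an independent set for nonzero \<open>u\<close>.\<close>

definition lattice_basis :: "real^2 \<Rightarrow> real^2 \<Rightarrow> (real^2) set \<Rightarrow> bool" where
  "lattice_basis u v \<Lambda> \<longleftrightarrow>
     u \<noteq> v \<and> independent {u, v} \<and> \<Lambda> = {of_int a *\<^sub>R u + of_int b *\<^sub>R v | a b. True}"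

definition is_lattice :: "(real^2) set \<Rightarrow> bool" where
  "is_lattice \<Lambda> \<longleftrightarrow> (\<exists>u v. lattice_basis u v \<Lambda>)"

definition fundamental_parallelogram :: "real^2 \<Rightarrow> real^2 \<Rightarrow> (real^2) set" where
  "fundamental_parallelogram u v = {s *\<^sub>R u + t *\<^sub>R v | s t. s \<in> {0..<1} \<and> t \<in> {0..<1}}"

text \<open>The description is unique for every lattice: see \<open>lattice_det_eq\<close> below.\<close>

definition lattice_det :: "(real^2) set \<Rightarrow> real" where
  "lattice_det \<Lambda> =
     (THE d. \<exists>u v. lattice_basis u v \<Lambda> \<and> d = measure lebesgue (fundamental_parallelogram u v))"

definition kfold_lattice_packing :: "nat \<Rightarrow> (real^2) set \<Rightarrow> (real^2) set \<Rightarrow> (real^2) set \<Rightarrow> bool" where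
  "kfold_lattice_packing k D S \<Lambda> \<longleftrightarrow>
     is_lattice \<Lambda> \<and> kfold_translative_packing k D S \<Lambda> (\<lambda>v. v)"

definition lattice_packing_density :: "nat \<Rightarrow> (real^2) set \<Rightarrow> ereal" where
  "lattice_packing_density k S =
     Sup {ereal (measure lebesgue S / lattice_det \<Lambda>) | \<Lambda>. kfold_lattice_packing k UNIV S \<Lambda>}"

lemma measure_halfopen_unit_square: "measure lebesgue (halfopen_square 1) = 1"
  and lmeasurable_halfopen_unit_square: "halfopen_square 1 \<in> lmeasurable"
proof -
  have s: "box 0 1 \<subseteq> halfopen_square 1" "halfopen_square 1 \<subseteq> cbox 0 1"
    by (auto simp: halfopen_square_def mem_box_cart less_imp_le)
  have n: "negligible (cbox (0::real^2) 1 - box 0 1)"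
    by (rule negligible_frontier_interval)
  have n': "negligible (sym_diff (cbox 0 1) (halfopen_square 1))"
    by (rule negligible_subset[OF n]) (use s in auto)
  show "halfopen_square 1 \<in> lmeasurable"
    by (rule lmeasurable_negligible_symdiff[OF lmeasurable_cbox n'])
  have "(0::real^2) \<in> cbox 0 1"
    by (simp add: mem_box_cart)
  then have "cbox (0::real^2) 1 \<noteq> {}"
    by blast
  then have "measure lebesgue (cbox (0::real^2) 1) = 1"
    by (simp add: content_cbox_cart)
  then show "measure lebesgue (halfopen_square 1) = 1"
    using measure_negligible_symdiff[OF lmeasurable_cbox n'] by simp
qed

lemma measure_fundamental_parallelogram:
  "measure lebesgue (fundamental_parallelogram u v) = \<bar>u$1 * v$2 - u$2 * v$1\<bar>"
proof -
  define f :: "real^2 \<Rightarrow> real^2" where "f = (\<lambda>x. x$1 *\<^sub>R u + x$2 *\<^sub>R v)"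
  have lin: "linear f"
    by (auto simp: f_def algebra_simps intro!: linearI)
  have "fundamental_parallelogram u v = f ` halfopen_square 1"
  proof (intro equalityI subsetI)
    fix x assume "x \<in> fundamental_parallelogram u v"
    then obtain s t where "x = s *\<^sub>R u + t *\<^sub>R v" "s \<in> {0..<1}" "t \<in> {0..<1}"
      by (auto simp: fundamental_parallelogram_def)
    then have "x = f (vector [s, t])" "vector [s, t] \<in> halfopen_square 1"
      by (auto simp: f_def halfopen_square_def forall_2)
    then show "x \<in> f ` halfopen_square 1" by blast
  qed (auto simp: fundamental_parallelogram_def f_def halfopen_square_def)
  moreover have "det (matrix f) = u$1 * v$2 - u$2 * v$1"
    by (simp add: det_2 matrix_def f_def axis_def)
  ultimately show ?thesis
    using measure_linear_image[OF lin lmeasurable_halfopen_unit_square]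
    by (simp add: measure_halfopen_unit_square)
qed

lemma lattice_basis_cross_dvd:
  assumes "lattice_basis u v \<Lambda>" "lattice_basis u' v' \<Lambda>"
  obtains m :: int where "u'$1 * v'$2 - u'$2 * v'$1 = of_int m * (u$1 * v$2 - u$2 * v$1)"
proof -
  have "u' = of_int 1 *\<^sub>R u' + of_int 0 *\<^sub>R v'" "v' = of_int 0 *\<^sub>R u' + of_int 1 *\<^sub>R v'"
    by auto
  then have "u' \<in> \<Lambda>" "v' \<in> \<Lambda>"
    using assms(2) unfolding lattice_basis_def by blast+
  then obtain a b c d :: int
    where "u' = of_int a *\<^sub>R u + of_int b *\<^sub>R v" "v' = of_int c *\<^sub>R u + of_int d *\<^sub>R v"
    using assms(1) unfolding lattice_basis_def by blast
  then have "u'$1 * v'$2 - u'$2 * v'$1 = of_int (a * d - b * c) * (u$1 * v$2 - u$2 * v$1)"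
    by (simp add: algebra_simps)
  then show ?thesis by (rule that)
qed

lemma lattice_basis_area_unique:
  assumes "lattice_basis u v \<Lambda>" "lattice_basis u' v' \<Lambda>"
  shows "measure lebesgue (fundamental_parallelogram u v)
       = measure lebesgue (fundamental_parallelogram u' v')"
proof -
  define c where "c = u$1 * v$2 - u$2 * v$1"
  define c' where "c' = u'$1 * v'$2 - u'$2 * v'$1"
  obtain m :: int where m: "c' = of_int m * c"
    using lattice_basis_cross_dvd[OF assms] unfolding c_def c'_def by metis
  obtain n :: int where n: "c = of_int n * c'"
    using lattice_basis_cross_dvd[OF assms(2,1)] unfolding c_def c'_def by metis
  have "\<bar>c\<bar> = \<bar>c'\<bar>"
  proof (cases "c = 0")
    case False
    have "c = of_int n * (of_int m * c)"
      using n unfolding m .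
    with False have "real_of_int (m * n) = 1"
      by (simp add: mult.commute)
    then have "\<bar>m * n\<bar> = 1"
      by linarith
    then have "\<bar>m\<bar> = 1"
      by (rule abs_zmult_eq_1)
    then have "\<bar>real_of_int m\<bar> = 1" by linarith
    then show ?thesis by (simp only: m abs_mult mult_1_left)
  qed (use m in simp)
  then show ?thesis by (simp add: measure_fundamental_parallelogram c_def c'_def)
qed

lemma lattice_det_eq:
  assumes "lattice_basis u v \<Lambda>"
  shows "lattice_det \<Lambda> = measure lebesgue (fundamental_parallelogram u v)"
  unfolding lattice_det_def
proof (rule the_equality)
  show "\<exists>u' v'. lattice_basis u' v' \<Lambda> \<and>
      measure lebesgue (fundamental_parallelogram u v)
      = measure lebesgue (fundamental_parallelogram u' v')"
    using assms by blast
next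
  fix d
  assume "\<exists>u' v'. lattice_basis u' v' \<Lambda> \<and> d = measure lebesgue (fundamental_parallelogram u' v')"
  then show "d = measure lebesgue (fundamental_parallelogram u v)"
    using lattice_basis_area_unique[OF _ assms] by auto
qed

end

theory Submission
  imports Defs
begin

text \<open>
  The three quantities are linked by a cycle of inequalities:
  \<open>2k\<^sup>2/(2k+1)\<close> is at most the lattice density because of one explicit lattice
  (\<open>lattice_packing_density_ge\<close>), the lattice density is at most the translative density because
  a lattice packing of the plane can be cut down to a large square
  (\<open>lattice_packing_density_le_translative\<close>), and the translative density is at most
  \<open>2k\<^sup>2/(2k+1)\<close> (\<open>translative_packing_density_le\<close>). Only the last part is hard. In
  suitable affine coordinates the triangle is \<open>x \<ge> 0\<close>, \<open>y \<ge> 0\<close>, \<open>x + y \<le> 1\<close>; its translates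
  have their right angles at points \<open>z\<^sub>i\<close>.

  Upper bound. Let \<open>Q\<^sub>i\<close> be the quarter plane up and to the right of \<open>z\<^sub>i\<close>, and order
  the triangles by the coordinate sum of \<open>z\<^sub>i\<close>. Give a point \<open>p\<close> to those triangles \<open>i\<close> with
  \<open>p \<in> Q\<^sub>i\<close> that are among the last \<open>k\<close> of this kind in the order. The set given to \<open>i\<close> is a
  staircase, and every point is given to at most \<open>k\<close> triangles. Up to boundary points, the staircase of \<open>i\<close>
  contains the triangle itself: if \<open>p\<close> lies in it and in \<open>Q\<^sub>j\<close> for a later \<open>j\<close>, then \<open>p\<close> lies in the
  triangle \<open>j\<close> too, and this happens for fewer than \<open>k\<close> indices \<open>j\<close>. Two facts complete the proof.
  First, \<open>n\<close> staircases have together at most \<open>(2k-1)n\<close> reentrant corners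
  (\<open>sum_card_corner_pairs_le\<close>). Second, each reentrant corner lies on or beyond the hypotenuse, so
  that it removes at most \<open>\<epsilon>\<^sup>2/2\<close> from the strip of width \<open>\<epsilon>\<close> (measured in \<open>x + y\<close>) that adjoins
  the hypotenuse inside the unit square. The total area of the staircases is therefore at least
  \<open>n (1/2 + \<epsilon> - k\<epsilon>\<^sup>2)\<close>; the best choice \<open>\<epsilon> = 1/(2k)\<close> gives \<open>n (2k+1)/(4k)\<close>, and
  this is at most \<open>k\<close> times the area that is available
  (\<open>packing_of_right_triangles_bound\<close>).

  Lattice. After scaling by \<open>2k\<close>, take the pairs of integers whose difference is divisible by
  \<open>2k+1\<close>. The triangles with a given point in their interior correspond to lattice points in a reflected triangle,
  and each residue class of the difference has at most \<open>k\<close> members there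
  (\<open>lattice_points_in_reflected_triangle\<close>).
\<close>

section \<open>Counting the reentrant corners of the staircases\<close>

text \<open>Two translates may share a coordinate or a coordinate sum. Ties are broken by the index, so that
  the combinatorial arguments can use strict orders that refine those of the reals.\<close>

lemma exists_injective_ranking:
  fixes x :: "nat \<Rightarrow> real"
  obtains X :: "nat \<Rightarrow> nat" where "inj_on X {..<n}"
    and "\<And>i j. i < n \<Longrightarrow> j < n \<Longrightarrow> x i < x j \<Longrightarrow> X i < X j"
proof -
  define below where "below j = {i. i < n \<and> (x i < x j \<or> x i = x j \<and> i < j)}" for j
  have mono: "card (below i) < card (below j)"
    if "i < n" "x i < x j \<or> x i = x j \<and> i < j" for i j
  proof (rule psubset_card_mono)
    show "finite (below j)" by (simp add: below_def)
    have "i \<in> below j" "i \<notin> below i" using that by (auto simp: below_def)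
    moreover have "below i \<subseteq> below j" using that by (auto simp: below_def)
    ultimately show "below i \<subset> below j" by blast
  qed
  show ?thesis
  proof
    show "inj_on (\<lambda>j. card (below j)) {..<n}"
    proof (rule inj_onI)
      fix i j assume *: "i \<in> {..<n}" "j \<in> {..<n}" "card (below i) = card (below j)"
      show "i = j"
        using mono[of i j] mono[of j i] * by (cases "x i" "x j" rule: linorder_cases; cases i j rule: linorder_cases) auto
    qed
  qed (use mono in auto)
qed

lemma exists_initial_segment_of_card:
  fixes X :: "'i \<Rightarrow> 'b::linorder"
  assumes A: "finite A" and inj: "inj_on X A" and k: "1 \<le> k" "k \<le> card A"
  obtains j where "j \<in> A" and "card {l \<in> A. X l \<le> X j} = k"
proof -
  define r where "r j = card {l \<in> A. X l \<le> X j}" for j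
  have mono: "r i < r j" if "i \<in> A" "j \<in> A" "X i < X j" for i j
    unfolding r_def by (rule psubset_card_mono) (use that A in force)+
  have "inj_on r A"
  proof (rule inj_onI)
    fix i j assume "i \<in> A" "j \<in> A" "r i = r j"
    then show "i = j"
      using mono[of i j] mono[of j i] inj by (metis inj_onD less_irrefl linorder_neqE)
  qed
  moreover have "r ` A \<subseteq> {1..card A}"
  proof (clarsimp, intro conjI)
    fix j assume "j \<in> A"
    then have "{l \<in> A. X l \<le> X j} \<noteq> {}" by auto
    then show "Suc 0 \<le> r j" using A by (simp add: r_def Suc_le_eq card_gt_0_iff)
    show "r j \<le> card A" unfolding r_def by (rule card_mono) (use A in auto)
  qed
  ultimately have "r ` A = {1..card A}"
    by (intro card_subset_eq) (auto simp: card_image)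
  then obtain j where "j \<in> A" "r j = k" using k by (metis atLeastAtMost_iff imageE)
  then show ?thesis using that by (simp add: r_def)
qed

lemma exists_maximizer:
  fixes f :: "'i \<Rightarrow> 'b::linorder"
  assumes "finite A" "A \<noteq> {}"
  obtains m where "m \<in> A" and "\<And>l. l \<in> A \<Longrightarrow> f l \<le> f m"
proof -
  have "Max (f ` A) \<in> f ` A" using assms by (intro Max_in) auto
  then obtain m where "m \<in> A" "f m = Max (f ` A)" by (metis imageE)
  then show ?thesis using that assms by (metis Max_ge finite_imageI imageI)
qed

text \<open>The \<open>l\<close> with \<open>H i < H l\<close>, \<open>X l \<le> X j\<close> and \<open>Y l \<le> Y m\<close> are those that come after \<open>i\<close> in the order and
  have the point \<open>(X j, Y m)\<close> in their quarter plane. If there are exactly \<open>k\<close> of them, this point is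
  where the staircase of \<open>i\<close> ends, that is, a reentrant corner. A corner is recorded by the
  triangles \<open>j\<close> and \<open>m\<close> that give it its abscissa and its ordinate, rather than by
  these numbers, since the counting below charges corners to triangles.\<close>

definition corner_pairs ::
  "'i set \<Rightarrow> ('i \<Rightarrow> 'h::linorder) \<Rightarrow> ('i \<Rightarrow> 'x::linorder) \<Rightarrow> ('i \<Rightarrow> 'y::linorder) \<Rightarrow> nat \<Rightarrow> 'i
    \<Rightarrow> ('i \<times> 'i) set" where
  "corner_pairs J H X Y k i =
     {(j, m). j \<in> J \<and> m \<in> J \<and> H i < H j \<and> H i < H m \<and> X i < X j \<and> Y i < Y m \<and>
        X m \<le> X j \<and> Y j \<le> Y m \<and> card {l \<in> J. H i < H l \<and> X l \<le> X j \<and> Y l \<le> Y m} = k}"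

lemma finite_corner_pairs: "finite J \<Longrightarrow> finite (corner_pairs J H X Y k i)"
  by (rule finite_subset[of _ "J \<times> J"]) (auto simp: corner_pairs_def)

text \<open>For fixed \<open>j\<close>, move up the vertical ray from its vertex. Every \<open>m\<close> that
  gives a corner with \<open>H j < H m\<close> is itself counted at the highest such corner, where only \<open>k\<close>
  triangles are counted, and one of these is \<open>j\<close>.\<close>

lemma corner_pairs_below_first:
  assumes J: "finite J"
  shows "card {m. H j < H m \<and> (j, m) \<in> (\<Union>i\<in>J. corner_pairs J H X Y k i)} \<le> k - 1" (is "card ?M \<le> _")
proof (cases "?M = {}")
  case True then show ?thesis by (simp only: card.empty)
next
  case False
  have fin: "finite ?M" by (rule finite_subset[OF _ J]) (auto simp: corner_pairs_def)
  obtain m where m: "m \<in> ?M" and max: "\<And>m'. m' \<in> ?M \<Longrightarrow> Y m' \<le> Y m"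
    by (rule exists_maximizer[OF fin False, where f = Y]) blast
  from m obtain i' where i': "i' \<in> J" "(j, m) \<in> corner_pairs J H X Y k i'" by auto
  let ?S = "{l \<in> J. H i' < H l \<and> X l \<le> X j \<and> Y l \<le> Y m}"
  have "insert j ?M \<subseteq> ?S"
  proof
    fix l assume "l \<in> insert j ?M"
    then consider "l = j" | "l \<in> ?M" by blast
    then show "l \<in> ?S"
    proof cases
      case 1
      then show ?thesis using i'(2) by (auto simp: corner_pairs_def)
    next
      case 2
      then have "l \<in> J" "X l \<le> X j" "H j < H l" by (auto simp: corner_pairs_def)
      moreover have "H i' < H j" using i'(2) by (auto simp: corner_pairs_def)
      ultimately show ?thesis using max[OF 2] by simp
    qed
  qed
  then have "card (insert j ?M) \<le> card ?S" using J by (intro card_mono) auto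
  moreover have "card ?S = k" using i' by (simp add: corner_pairs_def)
  moreover have "card (insert j ?M) = Suc (card ?M)" using fin by (subst card_insert_disjoint) auto
  ultimately show ?thesis by simp
qed

lemma corner_pairs_swap:
  "corner_pairs J H Y X k i = prod.swap ` corner_pairs J H X Y k i"
proof -
  have "(j, m) \<in> corner_pairs J H Y X k i \<longleftrightarrow> (m, j) \<in> corner_pairs J H X Y k i" for j m
  proof -
    have "{l \<in> J. H i < H l \<and> Y l \<le> Y j \<and> X l \<le> X m} = {l \<in> J. H i < H l \<and> X l \<le> X m \<and> Y l \<le> Y j}" by auto
    then show ?thesis by (auto simp: corner_pairs_def)
  qed
  then show ?thesis by (force simp: image_iff)
qed

text \<open>At a given corner the number of later triangles determines \<open>i\<close>: of two candidates, the later
  one is itself counted for the earlier one.\<close>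

lemma corner_pairs_disjoint:
  assumes J: "finite J" and H: "inj_on H J" and i: "i \<in> J" "i' \<in> J" "i \<noteq> i'"
  shows "corner_pairs J H X Y k i \<inter> corner_pairs J H X Y k i' = {}"
proof -
  have *: False if "c \<in> corner_pairs J H X Y k i" "c \<in> corner_pairs J H X Y k i'" "i' \<in> J" "H i < H i'" for c i i'
  proof -
    obtain j m where [simp]: "c = (j, m)" by force
    have "card {l \<in> J. H i' < H l \<and> X l \<le> X j \<and> Y l \<le> Y m} < card {l \<in> J. H i < H l \<and> X l \<le> X j \<and> Y l \<le> Y m}"
    proof (rule psubset_card_mono)
      have "i' \<in> {l \<in> J. H i < H l \<and> X l \<le> X j \<and> Y l \<le> Y m}"
        using that by (auto simp: corner_pairs_def)
      then show "{l \<in> J. H i' < H l \<and> X l \<le> X j \<and> Y l \<le> Y m} \<subset> {l \<in> J. H i < H l \<and> X l \<le> X j \<and> Y l \<le> Y m}"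
        using that by auto
    qed (use J in simp)
    then show False using that by (simp add: corner_pairs_def)
  qed
  have "H i < H i' \<or> H i' < H i" using i H by (meson inj_on_contraD linorder_neqE)
  then show ?thesis using *[of _ i i'] *[of _ i' i] i by blast
qed

lemma card_corner_pairs_increasing:
  assumes J: "finite J"
  shows "card {(j, m) \<in> (\<Union>i\<in>J. corner_pairs J H X Y k i). H j < H m} \<le> (k - 1) * card J"
proof -
  let ?C = "\<Union>i\<in>J. corner_pairs J H X Y k i"
  have "{(j, m) \<in> ?C. H j < H m} = Sigma J (\<lambda>j. {m. H j < H m \<and> (j, m) \<in> ?C})"
    by (auto simp: corner_pairs_def)
  also have "card \<dots> = (\<Sum>j\<in>J. card {m. H j < H m \<and> (j, m) \<in> ?C})"
    by (rule card_SigmaI[OF J]) (auto intro: finite_subset[OF _ J] simp: corner_pairs_def)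
  also have "\<dots> \<le> (\<Sum>j\<in>J. k - 1)"
    by (intro sum_mono corner_pairs_below_first[OF J])
  finally show ?thesis by (simp add: mult.commute)
qed

text \<open>By disjointness it is enough to count the pairs \<open>(j, m)\<close> that occur for some \<open>i\<close>. There are at most
  \<open>card J\<close> with \<open>j = m\<close>, at most \<open>(k - 1) card J\<close> with \<open>j\<close> before \<open>m\<close>, and as many with \<open>m\<close> before
  \<open>j\<close>, by the symmetry that exchanges the axes.\<close>

lemma sum_card_corner_pairs_le:
  assumes J: "finite J" and H: "inj_on H J" and k: "1 \<le> k"
  shows "(\<Sum>i\<in>J. card (corner_pairs J H X Y k i)) \<le> (2 * k - 1) * card J"
proof -
  define C where "C = (\<Union>i\<in>J. corner_pairs J H X Y k i)"
  define C' where "C' = (\<Union>i\<in>J. corner_pairs J H Y X k i)"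
  have C': "C' = prod.swap ` C"
    unfolding C_def C'_def image_UN by (rule SUP_cong[OF refl corner_pairs_swap])
  have sub: "C \<subseteq> J \<times> J" by (auto simp: C_def corner_pairs_def)
  have one_side: "card {(j, m) \<in> C. H j < H m} \<le> (k - 1) * card J"
    and other_side: "card {(m, j) \<in> C'. H m < H j} \<le> (k - 1) * card J"
    unfolding C_def C'_def by (rule card_corner_pairs_increasing[OF J])+
  define up where "up = {(j, m) \<in> C. H j < H m}"
  define down where "down = {(m, j) \<in> C'. H m < H j}"
  have "finite (J \<times> J)" using J by simp
  then have finC: "finite C" "finite C'"
    using sub finite_subset unfolding C' by blast+
  then have fin: "finite up" "finite down"
    by (auto simp: up_def down_def intro: finite_subset)
  have cover: "C \<subseteq> (\<lambda>j. (j, j)) ` J \<union> up \<union> prod.swap ` down"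
  proof
    fix c assume c: "c \<in> C"
    obtain j m where cjm: "c = (j, m)" by force
    have jm: "j \<in> J" "m \<in> J" using c sub cjm by auto
    have "(m, j) \<in> C'" using c cjm unfolding C' by force
    consider "H j < H m" | "H m < H j" | "j = m"
      using H jm by (meson inj_onD linorder_neqE)
    then show "c \<in> (\<lambda>j. (j, j)) ` J \<union> up \<union> prod.swap ` down"
    proof cases
      case 1
      then show ?thesis using c cjm by (simp add: up_def)
    next
      case 2
      then have "(m, j) \<in> down" using \<open>(m, j) \<in> C'\<close> by (simp add: down_def)
      then show ?thesis unfolding cjm by (metis UnI2 image_eqI swap_simp)
    next
      case 3
      then show ?thesis using jm cjm by simp
    qed
  qed
  have "(\<Sum>i\<in>J. card (corner_pairs J H X Y k i)) = card C"
    unfolding C_def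
    by (intro card_UN_disjoint[symmetric] J ballI impI finite_corner_pairs
        corner_pairs_disjoint[OF J H])
  also have "\<dots> \<le> card ((\<lambda>j. (j, j)) ` J \<union> up \<union> prod.swap ` down)"
    by (rule card_mono[OF _ cover]) (use J fin in simp)
  also have "\<dots> \<le> card ((\<lambda>j. (j, j)) ` J) + card up + card (prod.swap ` down)"
    by (intro order.trans[OF card_Un_le] add_mono card_Un_le order.refl)
  also have "\<dots> \<le> card J + (k - 1) * card J + (k - 1) * card J"
    using one_side other_side card_image_le[OF J] card_image_le[OF fin(2)]
    unfolding up_def[symmetric] down_def[symmetric] by (intro add_mono) (auto intro: order.trans)
  also have "\<dots> = (2 * k - 1) * card J"
    using k by (cases k) (auto simp: algebra_simps)
  finally show ?thesis .
qed

section \<open>The area of the staircases\<close>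

text \<open>A negative \<open>r\<close> gives the triangle reflected in its vertex \<open>c\<close>.\<close>

definition right_triangle :: "real^2 \<Rightarrow> real \<Rightarrow> (real^2) set" where
  "right_triangle c r = convex hull {c, c + vector [r, 0], c + vector [0, r]}"

lemma lmeasurable_right_triangle: "right_triangle c r \<in> lmeasurable"
  unfolding right_triangle_def
  by (intro lmeasurable_compact compact_convex_hull finite_imp_compact) simp

lemma measure_right_triangle: "measure lebesgue (right_triangle c r) = r\<^sup>2 / 2"
proof -
  have "compact (right_triangle c r)"
    unfolding right_triangle_def by (intro compact_convex_hull finite_imp_compact) simp
  then have "right_triangle c r \<in> sets lborel"
    by (simp add: borel_compact)
  then have "measure lebesgue (right_triangle c r) = measure lborel (right_triangle c r)"
    by simp
  then show ?thesis
    by (simp add: right_triangle_def content_triangle power2_eq_square abs_mult)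
qed

lemma mem_right_triangle:
  assumes "0 \<le> r" "c$1 \<le> p$1" "c$2 \<le> p$2" "p$1 + p$2 \<le> c$1 + c$2 + r"
  shows "p \<in> right_triangle c r"
proof (cases "r = 0")
  case True
  then have "p = c" using assms by (simp add: vec_eq_iff forall_2)
  then show ?thesis by (simp add: right_triangle_def hull_inc)
next
  case False
  define s t where "s = (p$1 - c$1) / r" and "t = (p$2 - c$2) / r"
  have "p = c + s *\<^sub>R (c + vector [r, 0] - c) + t *\<^sub>R (c + vector [0, r] - c)"
    using False by (simp add: s_def t_def vec_eq_iff forall_2)
  moreover have "0 \<le> s" "0 \<le> t" "s + t \<le> 1"
    using assms False by (auto simp: s_def t_def simp flip: add_divide_distrib)
  ultimately show ?thesis unfolding right_triangle_def convex_hull_3_alt by blast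
qed

lemma mem_reflected_right_triangle:
  assumes "0 \<le> r" "p$1 \<le> c$1" "p$2 \<le> c$2" "c$1 + c$2 - r \<le> p$1 + p$2"
  shows "p \<in> right_triangle c (- r)"
proof (cases "r = 0")
  case True
  then have "p = c" using assms by (simp add: vec_eq_iff forall_2)
  then show ?thesis by (simp add: right_triangle_def hull_inc)
next
  case False
  define s t where "s = (c$1 - p$1) / r" and "t = (c$2 - p$2) / r"
  have "p = c + s *\<^sub>R (c + vector [- r, 0] - c) + t *\<^sub>R (c + vector [0, - r] - c)"
    using False by (simp add: s_def t_def vec_eq_iff forall_2)
  moreover have "0 \<le> s" "0 \<le> t" "s + t \<le> 1"
    using assms False by (auto simp: s_def t_def simp flip: add_divide_distrib)
  ultimately show ?thesis unfolding right_triangle_def convex_hull_3_alt by blast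
qed

lemma sum_measure_le_of_multiplicity:
  assumes J: "finite J" and G: "\<And>i. i \<in> J \<Longrightarrow> G i \<in> fmeasurable M" and D: "D \<in> fmeasurable M"
    and sub: "\<And>i. i \<in> J \<Longrightarrow> G i \<subseteq> D" and mult: "\<And>p. card {i \<in> J. p \<in> G i} \<le> k"
  shows "(\<Sum>i\<in>J. measure M (G i)) \<le> real k * measure M D"
proof -
  have int: "integrable M (indicat_real A)" if "A \<in> fmeasurable M" for A
    using that by (auto simp: less_top fmeasurable_def)
  have "(\<Sum>i\<in>J. measure M (G i)) = (\<Sum>i\<in>J. LINT p|M. indicat_real (G i) p)"
    using G by (intro sum.cong) (auto simp: fmeasurableD2)
  also have "\<dots> = (LINT p|M. (\<Sum>i\<in>J. indicat_real (G i) p))"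
    using G by (intro Bochner_Integration.integral_sum[symmetric] int)
  also have "\<dots> \<le> (LINT p|M. real k * indicat_real D p)"
  proof (rule integral_mono)
    fix p assume "p \<in> space M"
    have "(\<Sum>i\<in>J. indicat_real (G i) p) = real (card {i \<in> J. p \<in> G i})"
      using J by (simp add: indicator_def sum.If_cases Int_def)
    also have "\<dots> \<le> real k * indicat_real D p"
    proof (cases "p \<in> D")
      case False
      then have "{i \<in> J. p \<in> G i} = {}" using sub by auto
      then show ?thesis by (simp only: card.empty) simp
    qed (use mult in simp)
    finally show "(\<Sum>i\<in>J. indicat_real (G i) p) \<le> real k * indicat_real D p" .
  qed (use G D int in \<open>auto intro!: Bochner_Integration.integrable_sum integrable_mult_right\<close>)
  also have "\<dots> = real k * measure M D" using D by (simp add: fmeasurableD2)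
  finally show ?thesis .
qed

text \<open>If the point \<open>(a, b)\<close> were strictly below the hypotenuse of \<open>i\<close>, then a point slightly up and to the right of it
  would be inside \<open>i\<close> and also inside each of the \<open>k\<close> or more triangles in \<open>B\<close>: their vertices
  lie below and to the left of it, and \<open>x + y\<close> is at least as large on their hypotenuses as on that
  of \<open>i\<close>.\<close>

lemma crowded_corner_beyond_hypotenuse:
  fixes z :: "nat \<Rightarrow> real^2"
  assumes pack: "\<And>p :: real^2. card {i \<in> {..<n}. z i$1 < p$1 \<and> z i$2 < p$2 \<and> p$1 + p$2 < z i$1 + z i$2 + 1} \<le> k"
    and above: "\<And>l. l \<in> B \<Longrightarrow> l < n \<and> l \<noteq> i \<and> z i$1 + z i$2 \<le> z l$1 + z l$2 \<and> z l$1 \<le> a \<and> z l$2 \<le> b"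
    and B: "k \<le> card B" "finite B" and i: "i < n" "z i$1 \<le> a" "z i$2 \<le> b"
  shows "z i$1 + z i$2 + 1 \<le> a + b"
proof (rule ccontr)
  assume "\<not> ?thesis"
  then have less: "a + b < z i$1 + z i$2 + 1" by simp
  define d where "d = (z i$1 + z i$2 + 1 - a - b) / 4"
  have d: "d > 0" "a + b + 2 * d < z i$1 + z i$2 + 1" using less by (auto simp: d_def field_simps)
  define p :: "real^2" where "p = vector [a + d, b + d]"
  have "insert i B \<subseteq> {i \<in> {..<n}. z i$1 < p$1 \<and> z i$2 < p$2 \<and> p$1 + p$2 < z i$1 + z i$2 + 1}"
  proof
    fix l assume l: "l \<in> insert i B"
    then have "l < n" "z i$1 + z i$2 \<le> z l$1 + z l$2" "z l$1 \<le> a" "z l$2 \<le> b"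
      using above[of l] i by auto
    then show "l \<in> {i \<in> {..<n}. z i$1 < p$1 \<and> z i$2 < p$2 \<and> p$1 + p$2 < z i$1 + z i$2 + 1}"
      using d by (simp add: p_def)
  qed
  then have "card (insert i B) \<le> k"
    by (intro order.trans[OF card_mono pack[of p]]) auto
  moreover have "i \<notin> B" using above by blast
  ultimately show False using B by simp
qed

text \<open>From the staircase of \<open>i\<close>, keep what lies in the unit square at \<open>z i\<close> and satisfies
  \<open>x + y < z i$1 + z i$2 + 1 + \<epsilon>\<close>. This contains the set \<open>G i\<close>, which is the square
  without a triangle of leg \<open>1 - \<epsilon>\<close> at its top right vertex and
  without a triangle of leg \<open>\<epsilon>\<close> at each reentrant corner. Leg \<open>\<epsilon>\<close> is enough
  there, because the corner is on or beyond the hypotenuse.\<close>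

lemma packing_of_right_triangles_bound:
  fixes z :: "nat \<Rightarrow> real^2"
  assumes k: "1 \<le> k"
    and pack: "\<And>p :: real^2. card {i \<in> {..<n}. z i$1 < p$1 \<and> z i$2 < p$2 \<and> p$1 + p$2 < z i$1 + z i$2 + 1} \<le> k"
    and D: "D \<in> lmeasurable" and sub: "\<And>i. i < n \<Longrightarrow> cbox (z i) (z i + 1) \<subseteq> D"
  shows "real n * ((2 * real k + 1) / (4 * real k)) \<le> real k * measure lebesgue D"
proof -
  \<comment> \<open>This value maximizes the final lower bound \<open>n (1/2 + \<epsilon> - k\<epsilon>\<^sup>2)\<close>.\<close>
  define \<epsilon> where "\<epsilon> = 1 / (2 * real k)"
  have eps: "0 < \<epsilon>" "\<epsilon> \<le> 1" using k by (auto simp: \<epsilon>_def field_simps)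
  obtain H :: "nat \<Rightarrow> nat" where H: "inj_on H {..<n}"
    and H_less: "\<And>i j. i < n \<Longrightarrow> j < n \<Longrightarrow> z i$1 + z i$2 < z j$1 + z j$2 \<Longrightarrow> H i < H j"
    by (rule exists_injective_ranking[where x = "\<lambda>i. z i$1 + z i$2"]) blast
  obtain X :: "nat \<Rightarrow> nat" where X: "inj_on X {..<n}"
    and X_less: "\<And>i j. i < n \<Longrightarrow> j < n \<Longrightarrow> z i$1 < z j$1 \<Longrightarrow> X i < X j"
    by (rule exists_injective_ranking[where x = "\<lambda>i. z i$1"]) blast
  define C where "C = corner_pairs {..<n} H X (\<lambda>i. z i$2) k"
  define corner where "corner = (\<lambda>(j, m). right_triangle (vector [z j$1, z m$2]) \<epsilon>)"
  define top where "top i = right_triangle (z i + 1) (- (1 - \<epsilon>))" for i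
  define G where "G i = box (z i) (z i + 1) - (top i \<union> (\<Union>c\<in>C i. corner c))" for i
  have finC: "finite (C i)" for i by (simp add: C_def finite_corner_pairs)
  have meas_corner: "corner c \<in> lmeasurable" "measure lebesgue (corner c) = \<epsilon>\<^sup>2 / 2" for c
    by (auto simp: corner_def lmeasurable_right_triangle measure_right_triangle split: prod.splits)
  have meas_top: "top i \<in> lmeasurable" "measure lebesgue (top i) = (1 - \<epsilon>)\<^sup>2 / 2" for i
    by (auto simp: top_def lmeasurable_right_triangle measure_right_triangle power2_commute)
  have meas_UN: "(\<Union>c\<in>C i. corner c) \<in> lmeasurable" for i
    using finC meas_corner by (intro fmeasurable.finite_UN) auto
  have meas_G: "G i \<in> lmeasurable" for i
    unfolding G_def using meas_top meas_UN by (intro fmeasurable.Diff fmeasurable.Un) auto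
  have area: "1 - (1 - \<epsilon>)\<^sup>2 / 2 - real (card (C i)) * (\<epsilon>\<^sup>2 / 2) \<le> measure lebesgue (G i)" for i
  proof -
    have "measure lebesgue (box (z i) (z i + 1)) = 1"
    proof -
      have "cbox (z i) (z i + 1) \<noteq> {}" by (simp add: interval_ne_empty_cart)
      then have "measure lborel (cbox (z i) (z i + 1)) = 1" by (simp add: content_cbox_cart)
      moreover have "measure lborel (box (z i) (z i + 1)) = measure lborel (cbox (z i) (z i + 1))"
        by (simp add: measure_lborel_box_eq measure_lborel_cbox_eq)
      ultimately show ?thesis by simp
    qed
    moreover have "measure lebesgue (box (z i) (z i + 1))
        \<le> measure lebesgue (G i \<union> (top i \<union> (\<Union>c\<in>C i. corner c)))"
      using meas_G meas_top meas_UN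
      by (intro measure_mono_fmeasurable fmeasurable.Un) (auto simp: G_def)
    moreover have "\<dots> \<le> measure lebesgue (G i) + (measure lebesgue (top i) + measure lebesgue (\<Union>c\<in>C i. corner c))"
      using meas_G meas_top meas_UN
      by (intro order.trans[OF measure_Un_le] add_left_mono measure_Un_le) (auto simp: fmeasurableD)
    moreover have "measure lebesgue (\<Union>c\<in>C i. corner c) \<le> (\<Sum>c\<in>C i. measure lebesgue (corner c))"
      using finC meas_corner by (intro measure_UNION_le) (auto simp: fmeasurableD)
    ultimately show ?thesis using meas_top(2)[of i] by (simp add: meas_corner)
  qed
  have overlap: "card {i \<in> {..<n}. p \<in> G i} \<le> k" for p
  proof (rule ccontr)
    let ?S = "{i \<in> {..<n}. p \<in> G i}"
    assume "\<not> card ?S \<le> k"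
    then have card_S: "Suc k \<le> card ?S" by simp
    then have "?S \<noteq> {}" by (metis card.empty not_less_eq_eq le0)
    moreover have "finite ?S" by simp
    ultimately obtain i where i: "i \<in> ?S" and least: "\<And>l. l \<in> ?S \<Longrightarrow> - int (H l) \<le> - int (H i)"
      using exists_maximizer[where f = "\<lambda>l. - int (H l)" and A = ?S] by blast
    have "i < n" and pG: "p \<in> G i" using i by auto
    then have p_box: "z i$1 < p$1" "z i$2 < p$2" "p$1 < z i$1 + 1" "p$2 < z i$2 + 1"
      by (auto simp: G_def mem_box_cart forall_2)
    define A where "A = {l \<in> {..<n}. H i < H l \<and> z l$1 \<le> p$1 \<and> z l$2 \<le> p$2}"
    \<comment> \<open>The other members of \<open>?S\<close> come after \<open>i\<close> and have \<open>p\<close> in their quarter planes, so \<open>p\<close> is not in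
      the staircase of \<open>i\<close>. It remains to find the reentrant corner that cuts \<open>p\<close> off.\<close>
    have "?S - {i} \<subseteq> A"
    proof
      fix l assume l: "l \<in> ?S - {i}"
      then have "H i \<noteq> H l" using H \<open>i < n\<close> by (auto dest: inj_onD)
      then show "l \<in> A" using l least[of l] by (auto simp: A_def G_def mem_box_cart forall_2 intro: less_imp_le)
    qed
    then have "card (?S - {i}) \<le> card A" by (intro card_mono) (auto simp: A_def)
    then have "k \<le> card A" using card_S i by simp
    moreover have "finite A" "inj_on X A" by (auto simp: A_def intro: inj_on_subset[OF X])
    ultimately obtain j where j: "j \<in> A" and card_j: "card {l \<in> A. X l \<le> X j} = k"
      using exists_initial_segment_of_card k by blast
    \<comment> \<open>The \<open>k\<close> leftmost triangles of \<open>A\<close> determine the corner: its abscissa is that of the last of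
      them, and its ordinate is the largest one among them.\<close>
    define A' where "A' = {l \<in> A. X l \<le> X j}"
    have "finite A'" "A' \<noteq> {}" using j \<open>finite A\<close> by (auto simp: A'_def)
    then obtain m where m: "m \<in> A'" and max: "\<And>l. l \<in> A' \<Longrightarrow> z l$2 \<le> z m$2"
      by (rule exists_maximizer[where f = "\<lambda>l. z l$2"]) blast
    have le_j: "z l$1 \<le> z j$1" if "l \<in> A'" for l
      using X_less[of j l] that j by (force simp: A'_def A_def)
    have above: "l < n \<and> l \<noteq> i \<and> z i$1 + z i$2 \<le> z l$1 + z l$2" if "l \<in> A'" for l
      using that H_less[of l i] \<open>i < n\<close> by (force simp: A'_def A_def)
    have A'_eq: "{l \<in> {..<n}. H i < H l \<and> X l \<le> X j \<and> z l$2 \<le> z m$2} = A'"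
    proof (intro equalityI subsetI)
      fix l assume l: "l \<in> {l \<in> {..<n}. H i < H l \<and> X l \<le> X j \<and> z l$2 \<le> z m$2}"
      have "z j$1 \<le> p$1" "z m$2 \<le> p$2" using j m by (auto simp: A_def A'_def)
      moreover have "z l$1 \<le> z j$1" using X_less[of j l] l j by (force simp: A_def)
      ultimately show "l \<in> A'" using l by (auto simp: A_def A'_def)
    qed (use max in \<open>auto simp: A_def A'_def\<close>)
    note beyond = crowded_corner_beyond_hypotenuse[OF pack, where B = A' and i = i]
    have A': "k \<le> card A'" "finite A'" using card_j \<open>finite A\<close> by (auto simp: A'_def)
    have p_ge: "z j$1 \<le> p$1" "z m$2 \<le> p$2" using j m by (auto simp: A_def A'_def)
    \<comment> \<open>If the corner were not to the right of the vertex \<open>z i\<close>, it could be moved to the left edge of the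
      square of \<open>i\<close>. To be beyond the hypotenuse it would then have to be above the square, and could
      not be below \<open>p\<close>. The argument for \<open>i_m\<close> is the same with the axes exchanged.\<close>
    have i_j: "z i$1 < z j$1"
    proof (rule ccontr)
      assume "\<not> z i$1 < z j$1"
      then have "z i$1 + z i$2 + 1 \<le> z i$1 + max (z i$2) (z m$2)"
        using above le_j max A' \<open>i < n\<close> by (intro beyond) (force intro: order.trans)+
      then show False using p_box p_ge by (simp add: max_def split: if_splits)
    qed
    have i_m: "z i$2 < z m$2"
    proof (rule ccontr)
      assume "\<not> z i$2 < z m$2"
      then have "z i$1 + z i$2 + 1 \<le> z j$1 + z i$2"
        using above le_j max A' \<open>i < n\<close> i_j by (intro beyond) (force intro: order.trans)+
      then show False using p_box p_ge by simp
    qed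
    have "(j, m) \<in> C i"
      using j m i_j i_m X_less[of i j] \<open>i < n\<close> max[of j] card_j
      unfolding C_def corner_pairs_def mem_Collect_eq prod.case A'_eq by (auto simp: A_def A'_def)
    moreover have "z i$1 + z i$2 + 1 \<le> z j$1 + z m$2"
      using above le_j max A' \<open>i < n\<close> i_j i_m by (intro beyond) auto
    moreover have "p$1 + p$2 < z i$1 + z i$2 + 1 + \<epsilon>"
    proof (rule ccontr)
      assume "\<not> ?thesis"
      then have "p \<in> top i"
        unfolding top_def using p_box eps by (intro mem_reflected_right_triangle) auto
      then show False using pG by (simp add: G_def)
    qed
    ultimately have "(j, m) \<in> C i" "p \<in> corner (j, m)"
      unfolding corner_def prod.case using eps p_ge by (auto intro!: mem_right_triangle)
    then show False using pG by (auto simp: G_def)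
  qed
  have "real (\<Sum>i<n. card (C i)) \<le> real ((2 * k - 1) * n)"
    unfolding C_def of_nat_le_iff using sum_card_corner_pairs_le[OF _ H k, where X = X and Y = "\<lambda>i. z i$2"] by simp
  then have count: "(\<Sum>i<n. real (card (C i))) \<le> (2 * real k - 1) * real n"
    using k by (simp add: of_nat_diff)
  have "real n * (1 - (1 - \<epsilon>)\<^sup>2 / 2) - (2 * real k - 1) * real n * (\<epsilon>\<^sup>2 / 2)
      \<le> real n * (1 - (1 - \<epsilon>)\<^sup>2 / 2) - (\<Sum>i<n. real (card (C i))) * (\<epsilon>\<^sup>2 / 2)"
    using count by (intro diff_left_mono mult_right_mono) auto
  also have "\<dots> = (\<Sum>i<n. 1 - (1 - \<epsilon>)\<^sup>2 / 2 - real (card (C i)) * (\<epsilon>\<^sup>2 / 2))"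
    by (simp add: sum_subtractf flip: sum_distrib_right sum_divide_distrib)
  also have "\<dots> \<le> (\<Sum>i<n. measure lebesgue (G i))" by (intro sum_mono area)
  also have "\<dots> \<le> real k * measure lebesgue D"
  proof (rule sum_measure_le_of_multiplicity)
    fix i assume "i \<in> {..<n}"
    then show "G i \<subseteq> D" using sub[of i] box_subset_cbox[of "z i" "z i + 1"] by (auto simp: G_def)
  qed (use meas_G D overlap in auto)
  finally have "real n * (1 - (1 - \<epsilon>)\<^sup>2 / 2) - (2 * real k - 1) * real n * (\<epsilon>\<^sup>2 / 2)
     \<le> real k * measure lebesgue D" .
  moreover have "real n * (1 - (1 - \<epsilon>)\<^sup>2 / 2) - (2 * real k - 1) * real n * (\<epsilon>\<^sup>2 / 2)
     = real n * ((2 * real k + 1) / (4 * real k))"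
    using k by (simp add: \<epsilon>_def field_simps power2_eq_square)
  ultimately show ?thesis by simp
qed

section \<open>Affine coordinates for a triangle\<close>

definition cross2 :: "real^2 \<Rightarrow> real^2 \<Rightarrow> real" where
  "cross2 u v = u$1 * v$2 - u$2 * v$1"

definition coord_map :: "real^2 \<Rightarrow> real^2 \<Rightarrow> real^2 \<Rightarrow> real^2" where
  "coord_map e f z = z$1 *\<^sub>R e + z$2 *\<^sub>R f"

lemma linear_coord_map: "linear (coord_map e f)"
  by (auto simp: coord_map_def algebra_simps intro!: linearI)

lemma det_coord_map: "det (matrix (coord_map e f)) = cross2 e f"
  by (simp add: det_2 matrix_def coord_map_def axis_def cross2_def)

lemma cross2_coord_map: "cross2 (coord_map e f x) (coord_map e f y) = cross2 e f * cross2 x y"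
  by (simp add: coord_map_def cross2_def algebra_simps)

lemma bij_coord_map:
  assumes "cross2 e f \<noteq> 0"
  shows "bij (coord_map e f)"
proof -
  have "z = 0" if "coord_map e f z = 0" for z
  proof -
    have "cross2 (coord_map e f z) f = z$1 * cross2 e f" "cross2 e (coord_map e f z) = z$2 * cross2 e f"
      by (simp_all add: coord_map_def cross2_def algebra_simps)
    then have "z$1 = 0" "z$2 = 0" using assms that by (simp_all add: cross2_def)
    then show ?thesis by (simp add: vec_eq_iff forall_2)
  qed
  then have "inj (coord_map e f)"
    using linear_injective_0[OF linear_coord_map] by blast
  then show ?thesis
    using linear_inj_imp_surj[OF linear_coord_map] by (simp add: bij_def)
qed

lemma measure_coord_map_image:
  "S \<in> lmeasurable \<Longrightarrow> measure lebesgue (coord_map e f ` S) = \<bar>cross2 e f\<bar> * measure lebesgue S"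
  using measure_linear_image[OF linear_coord_map] by (simp add: det_coord_map)

lemma independent_pair_iff_cross2: "u \<noteq> v \<and> independent {u, v} \<longleftrightarrow> cross2 u v \<noteq> 0"
proof
  assume "u \<noteq> v \<and> independent {u, v}"
  then have v: "v \<noteq> 0" and u: "u \<notin> span {v}"
    by (auto simp: independent_insert dependent_single)
  show "cross2 u v \<noteq> 0"
  proof
    assume 0: "cross2 u v = 0"
    have "v$1 \<noteq> 0 \<or> v$2 \<noteq> 0" using v by (simp add: vec_eq_iff forall_2)
    then have "u = (u$1 / v$1) *\<^sub>R v \<or> u = (u$2 / v$2) *\<^sub>R v"
      using 0 by (auto simp: vec_eq_iff forall_2 cross2_def field_simps)
    then have "u \<in> span {v}" by (metis span_base span_scale singletonI)
    with u show False ..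
  qed
next
  assume n0: "cross2 u v \<noteq> 0"
  then have "v \<noteq> 0" "u \<noteq> v" by (auto simp: cross2_def)
  moreover have "u \<notin> span {v}"
    using n0 by (auto simp: span_singleton cross2_def)
  ultimately show "u \<noteq> v \<and> independent {u, v}"
    by (auto simp: independent_insert dependent_single)
qed

lemma right_triangle_0_1: "right_triangle 0 1 = {z. 0 \<le> z$1 \<and> 0 \<le> z$2 \<and> z$1 + z$2 \<le> 1}"
  (is "?l = ?r")
proof
  show "?r \<subseteq> ?l" by (auto intro!: mem_right_triangle)
  show "?l \<subseteq> ?r"
    unfolding right_triangle_def convex_hull_3_alt by (auto simp: add_nonneg_nonneg)
qed

lemma interior_right_triangle_0_1:
  "interior (right_triangle 0 1) = {z. 0 < z$1 \<and> 0 < z$2 \<and> z$1 + z$2 < 1}"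
proof -
  have eq: "right_triangle 0 1 = {z. z$1 \<ge> 0} \<inter> {z. z$2 \<ge> 0} \<inter> {z. vector [1, 1] \<bullet> z \<le> 1}"
    by (auto simp: right_triangle_0_1 inner_vec_def sum_2)
  have "vector [1, 1] \<noteq> (0 :: real^2)" by (simp add: vec_eq_iff forall_2)
  then have "interior {z::real^2. vector [1, 1] \<bullet> z \<le> 1} = {z. vector [1, 1] \<bullet> z < 1}"
    by (rule interior_halfspace_le)
  then show ?thesis unfolding eq by (auto simp: inner_vec_def sum_2)
qed

lemma triangle_in_coordinates:
  assumes "is_triangle T"
  obtains a e f where "cross2 e f \<noteq> 0" and "T = (\<lambda>z. a + coord_map e f z) ` right_triangle 0 1"
    and "measure lebesgue T = \<bar>cross2 e f\<bar> / 2"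
proof -
  obtain a b c where nc: "\<not> collinear {a, b, c}" and T: "T = convex hull {a, b, c}"
    using assms unfolding is_triangle_def by blast
  have T_eq: "T = (\<lambda>z. a + coord_map (b - a) (c - a) z) ` right_triangle 0 1"
  proof (intro equalityI subsetI)
    fix x assume "x \<in> T"
    then obtain s t where "x = a + s *\<^sub>R (b - a) + t *\<^sub>R (c - a)" "0 \<le> s" "0 \<le> t" "s + t \<le> 1"
      unfolding T convex_hull_3_alt by blast
    then have "x = a + coord_map (b - a) (c - a) (vector [s, t])" "vector [s, t] \<in> right_triangle 0 1"
      by (auto simp: coord_map_def right_triangle_0_1)
    then show "x \<in> (\<lambda>z. a + coord_map (b - a) (c - a) z) ` right_triangle 0 1" by blast
  next
    fix x assume "x \<in> (\<lambda>z. a + coord_map (b - a) (c - a) z) ` right_triangle 0 1"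
    then show "x \<in> T"
      unfolding T convex_hull_3_alt right_triangle_0_1 coord_map_def by (auto simp: add.assoc)
  qed
  have "T = (+) a ` coord_map (b - a) (c - a) ` right_triangle 0 1"
    unfolding T_eq image_image ..
  then have area: "measure lebesgue T = \<bar>cross2 (b - a) (c - a)\<bar> / 2"
    by (simp add: measure_translation measure_coord_map_image lmeasurable_right_triangle measure_right_triangle)
  have "\<not> collinear {0, b - a, c - a}"
    using nc collinear_3[of b a c] by (simp add: insert_commute)
  then have b: "b - a \<noteq> 0" and "\<And>r. c - a \<noteq> r *\<^sub>R (b - a)"
    unfolding collinear_lemma by blast+
  then have "c - a \<notin> span {b - a}" unfolding span_singleton by blast
  moreover from this have "c - a \<noteq> b - a" using span_base by blast
  ultimately have "cross2 (c - a) (b - a) \<noteq> 0"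
    unfolding independent_pair_iff_cross2[symmetric] using b by (simp add: independent_insert)
  then have "cross2 (b - a) (c - a) \<noteq> 0" by (simp add: cross2_def mult.commute)
  with T_eq area that show ?thesis by blast
qed

lemma mem_interior_translated_triangle:
  assumes "cross2 e f \<noteq> 0"
  shows "a + coord_map e f p \<in> interior ((+) (coord_map e f w) ` (\<lambda>z. a + coord_map e f z) ` right_triangle 0 1)
    \<longleftrightarrow> w$1 < p$1 \<and> w$2 < p$2 \<and> p$1 + p$2 < w$1 + w$2 + 1"
proof -
  let ?L = "coord_map e f"
  have inj: "inj ?L" using bij_coord_map[OF assms] by (simp add: bij_def)
  have "(+) (?L w) ` (\<lambda>z. a + ?L z) ` right_triangle 0 1 = (+) (?L w + a) ` ?L ` right_triangle 0 1"
    by (simp add: image_image add.assoc)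
  then have "interior ((+) (?L w) ` (\<lambda>z. a + ?L z) ` right_triangle 0 1)
      = (+) (?L w + a) ` ?L ` interior (right_triangle 0 1)"
    by (simp only: interior_translation interior_injective_linear_image[OF linear_coord_map inj])
  moreover have "a + ?L p = ?L w + a + ?L q \<longleftrightarrow> q = p - w" for q
  proof -
    have "a + ?L p = ?L w + a + ?L q \<longleftrightarrow> ?L p = ?L (w + q)"
      by (auto simp: linear_add[OF linear_coord_map] algebra_simps)
    also have "\<dots> \<longleftrightarrow> q = p - w" using inj by (auto simp: inj_eq)
    finally show ?thesis .
  qed
  ultimately have "a + ?L p \<in> interior ((+) (?L w) ` (\<lambda>z. a + ?L z) ` right_triangle 0 1)
      \<longleftrightarrow> p - w \<in> interior (right_triangle 0 1)"
    by (auto simp: image_iff)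
  then show ?thesis by (auto simp: interior_right_triangle_0_1)
qed

section \<open>The upper bound for translative packings\<close>

lemma measure_halfopen_square:
  assumes "0 \<le> l"
  shows "measure lebesgue (halfopen_square l) = l\<^sup>2"
proof -
  have s: "box 0 (vec l) \<subseteq> halfopen_square l" "halfopen_square l \<subseteq> cbox 0 (vec l)"
    by (auto simp: halfopen_square_def mem_box_cart less_imp_le)
  have "negligible (cbox (0::real^2) (vec l) - box 0 (vec l))"
    by (rule negligible_frontier_interval)
  then have "negligible (sym_diff (cbox 0 (vec l)) (halfopen_square l))"
    by (rule negligible_subset) (use s in auto)
  then have "measure lebesgue (halfopen_square l) = measure lebesgue (cbox (0::real^2) (vec l))"
    using measure_negligible_symdiff[OF lmeasurable_cbox] by blast
  also have "\<dots> = l\<^sup>2"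
    using assms by (simp add: content_cbox_if_cart interval_eq_empty_cart power2_eq_square not_less)
  finally show ?thesis .
qed

text \<open>In affine coordinates the square becomes a parallelogram. The unit squares at the \<open>z\<^sub>i\<close> may stick out of
  it by a bounded amount, so the area that is available is that of a slightly larger square. Here \<open>c\<close>
  bounds the norm of the image of the unit square under the coordinate map.\<close>

lemma translative_packing_size_bound:
  assumes T: "is_triangle T" and k: "1 \<le> k"
  obtains c where "0 \<le> c"
    and "\<And>l n t. 0 < l \<Longrightarrow> kfold_translative_packing k (halfopen_square l) T {..<n::nat} t
      \<Longrightarrow> real n * measure lebesgue T \<le> 2 * (real k)\<^sup>2 / (2 * real k + 1) * (l + 2 * c)\<^sup>2"
proof -
  obtain a e f where ef: "cross2 e f \<noteq> 0" and T_eq: "T = (\<lambda>z. a + coord_map e f z) ` right_triangle 0 1"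
    and area: "measure lebesgue T = \<bar>cross2 e f\<bar> / 2"
    by (rule triangle_in_coordinates[OF T])
  let ?L = "coord_map e f"
  note lin = linear_coord_map[of e f]
  have bij: "bij ?L" by (rule bij_coord_map[OF ef])
  have "bounded (?L ` cbox 0 1)"
    by (intro bounded_linear_image bounded_cbox) (simp add: lin linear_conv_bounded_linear[symmetric])
  then obtain c where c: "\<And>r. r \<in> cbox 0 1 \<Longrightarrow> norm (?L r) \<le> c"
    unfolding bounded_iff by blast
  have "(0 :: real^2) \<in> cbox 0 1" by (simp add: mem_box_cart)
  then have c0: "0 \<le> c" using c norm_ge_zero order.trans by blast
  show ?thesis
  proof (rule that[OF c0])
    fix l :: real and n and t :: "nat \<Rightarrow> real^2"
    assume l: "0 < l" and "kfold_translative_packing k (halfopen_square l) T {..<n} t"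
    then have inside: "\<And>i. i < n \<Longrightarrow> (+) (t i) ` T \<subseteq> halfopen_square l"
      and pack: "\<And>x. x \<in> halfopen_square l \<Longrightarrow> card {i \<in> {..<n}. x \<in> interior ((+) (t i) ` T)} \<le> k"
      unfolding kfold_translative_packing_def kfold_packing_def by blast+
    define z where "z i = inv ?L (t i)" for i
    have z: "t i = ?L (z i)" for i
      using bij by (simp add: z_def surj_f_inv_f bij_is_surj)
    define B :: "(real^2) set" where "B = cbox (vec (- c)) (vec (l + c))"
    define D where "D = {q. a + ?L q \<in> B}"
    have LD: "?L ` D = (+) (- a) ` B"
    proof (intro equalityI subsetI)
      fix x assume "x \<in> (+) (- a) ` B"
      then have "a + x \<in> B" by auto
      moreover obtain q where "x = ?L q" using bij_is_surj[OF bij] by (rule surjE)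
      ultimately show "x \<in> ?L ` D" by (simp add: D_def)
    next
      fix x assume "x \<in> ?L ` D"
      then have "x = - a + (a + x)" "a + x \<in> B" by (auto simp: D_def)
      then show "x \<in> (+) (- a) ` B" by (rule image_eqI)
    qed
    obtain g where g: "linear g" "g \<circ> ?L = id"
      using linear_injective_left_inverse[OF lin] bij by (auto simp: bij_def)
    have "D = g ` (+) (- a) ` B" unfolding LD[symmetric] image_image using g(2) by (simp add: fun_eq_iff)
    moreover have "g ` (+) (- a) ` B \<in> lmeasurable"
      unfolding B_def by (intro measurable_linear_image g measurable_translation lmeasurable_cbox)
    ultimately have D: "D \<in> lmeasurable" by simp
    have "\<bar>cross2 e f\<bar> * measure lebesgue D = measure lebesgue B"
      using measure_coord_map_image[OF D, of e f] unfolding LD measure_translation by (rule sym)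
    also have "\<dots> = (l + 2 * c)\<^sup>2"
      using l c0
      by (simp add: B_def content_cbox_if_cart interval_eq_empty_cart power2_eq_square not_less add.commute)
    finally have meas_D: "\<bar>cross2 e f\<bar> * measure lebesgue D = (l + 2 * c)\<^sup>2" .
    have "real n * ((2 * real k + 1) / (4 * real k)) \<le> real k * measure lebesgue D"
    proof (rule packing_of_right_triangles_bound[OF k _ D])
      fix p :: "real^2"
      have eq: "{i \<in> {..<n}. z i$1 < p$1 \<and> z i$2 < p$2 \<and> p$1 + p$2 < z i$1 + z i$2 + 1}
          = {i \<in> {..<n}. a + ?L p \<in> interior ((+) (t i) ` T)}"
        unfolding z T_eq mem_interior_translated_triangle[OF ef] ..
      show "card {i \<in> {..<n}. z i$1 < p$1 \<and> z i$2 < p$2 \<and> p$1 + p$2 < z i$1 + z i$2 + 1} \<le> k"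
      proof (cases "a + ?L p \<in> halfopen_square l")
        case True then show ?thesis unfolding eq by (rule pack)
      next
        case False
        then have "{i \<in> {..<n}. a + ?L p \<in> interior ((+) (t i) ` T)} = {}"
          using inside interior_subset by blast
        then show ?thesis unfolding eq by (simp only: card.empty)
      qed
    next
      fix i assume i: "i < n"
      show "cbox (z i) (z i + 1) \<subseteq> D"
      proof
        fix q assume q: "q \<in> cbox (z i) (z i + 1)"
        have "a + ?L q = (t i + a) + ?L (q - z i)"
          by (simp add: z linear_diff[OF lin])
        moreover have "norm (?L (q - z i)) \<le> c"
          using q by (intro c) (auto simp: mem_box_cart algebra_simps)
        moreover have "a + ?L 0 \<in> T"
          unfolding T_eq by (rule imageI) (simp add: right_triangle_0_1)
        then have "t i + a \<in> (+) (t i) ` T"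
          by (simp add: linear_0[OF lin])
        then have "t i + a \<in> halfopen_square l" using inside[OF i] by blast
        ultimately have "- c \<le> (a + ?L q)$j \<and> (a + ?L q)$j \<le> l + c" for j
          using component_le_norm_cart[of "?L (q - z i)" j] unfolding halfopen_square_def
          by (smt (verit) mem_Collect_eq vector_add_component)
        then show "q \<in> D" by (simp add: D_def B_def mem_box_cart)
      qed
    qed
    then have "\<bar>cross2 e f\<bar> * (real n * ((2 * real k + 1) / (4 * real k))) \<le> \<bar>cross2 e f\<bar> * (real k * measure lebesgue D)"
      by (intro mult_left_mono) auto
    also have "\<dots> = real k * (l + 2 * c)\<^sup>2" by (simp add: meas_D[symmetric])
    finally show "real n * measure lebesgue T \<le> 2 * (real k)\<^sup>2 / (2 * real k + 1) * (l + 2 * c)\<^sup>2"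
      using k by (simp add: area field_simps power2_eq_square)
  qed
qed

lemma translative_packing_density_le:
  assumes T: "is_triangle T" and k: "1 \<le> k"
  shows "translative_packing_density k T \<le> ereal (2 * (real k)\<^sup>2 / (2 * real k + 1))"
proof -
  obtain c where c: "0 \<le> c" and bound: "\<And>l n t. 0 < l \<Longrightarrow>
      kfold_translative_packing k (halfopen_square l) T {..<n::nat} t \<Longrightarrow>
      real n * measure lebesgue T \<le> 2 * (real k)\<^sup>2 / (2 * real k + 1) * (l + 2 * c)\<^sup>2"
    using translative_packing_size_bound[OF T k] by blast
  define \<delta> where "\<delta> = 2 * (real k)\<^sup>2 / (2 * real k + 1)"
  have T_pos: "0 < measure lebesgue T"
    using triangle_in_coordinates[OF T] by (metis half_gt_zero zero_less_abs_iff)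
  have le: "ereal_of_enat (max_packing_number T k l) * ereal (measure lebesgue T)
      / ereal (measure lebesgue (halfopen_square l)) \<le> ereal (\<delta> * (1 + 2 * c / l)\<^sup>2)" if l: "0 < l" for l
  proof -
    have "max_packing_number T k l \<le> enat (nat \<lfloor>\<delta> * (l + 2 * c)\<^sup>2 / measure lebesgue T\<rfloor>)"
      unfolding max_packing_number_def
    proof (rule Sup_least, clarsimp)
      fix n and t :: "nat \<Rightarrow> real^2"
      assume "kfold_translative_packing k (halfopen_square l) T {..<n} t"
      from bound[OF l this] have "real n \<le> \<delta> * (l + 2 * c)\<^sup>2 / measure lebesgue T"
        unfolding pos_le_divide_eq[OF T_pos] \<delta>_def .
      then show "n \<le> nat \<lfloor>\<delta> * (l + 2 * c)\<^sup>2 / measure lebesgue T\<rfloor>" by linarith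
    qed
    then obtain N where N: "max_packing_number T k l = enat N" "N \<le> nat \<lfloor>\<delta> * (l + 2 * c)\<^sup>2 / measure lebesgue T\<rfloor>"
      by (cases "max_packing_number T k l") auto
    have "0 \<le> \<delta> * (l + 2 * c)\<^sup>2 / measure lebesgue T" by (simp add: \<delta>_def)
    then have "real N \<le> \<delta> * (l + 2 * c)\<^sup>2 / measure lebesgue T" using N(2) by linarith
    then have "real N * measure lebesgue T \<le> \<delta> * (l + 2 * c)\<^sup>2" using T_pos by (simp add: pos_le_divide_eq)
    then have "real N * measure lebesgue T / l\<^sup>2 \<le> \<delta> * (l + 2 * c)\<^sup>2 / l\<^sup>2" by (rule divide_right_mono) simp
    also have "\<dots> = \<delta> * (1 + 2 * c / l)\<^sup>2" using l by (simp add: field_simps power2_eq_square)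
    finally show ?thesis using l by (simp add: N(1) measure_halfopen_square)
  qed
  have "translative_packing_density k T \<le> Limsup at_top (\<lambda>l. ereal (\<delta> * (1 + 2 * c / l)\<^sup>2))"
    unfolding translative_packing_density_def
    by (intro Limsup_mono eventually_mono[OF eventually_gt_at_top[of 0]] le)
  also have "\<dots> = ereal \<delta>"
  proof (rule lim_imp_Limsup)
    have "((\<lambda>l. \<delta> * (1 + 2 * c / l)\<^sup>2) \<longlongrightarrow> \<delta> * (1 + 0)\<^sup>2) at_top"
      by (intro tendsto_intros tendsto_divide_0[OF tendsto_const] filterlim_at_top_imp_at_infinity filterlim_ident)
    then show "((\<lambda>l. ereal (\<delta> * (1 + 2 * c / l)\<^sup>2)) \<longlongrightarrow> ereal \<delta>) at_top" by simp
  qed simp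
  finally show ?thesis by (simp add: \<delta>_def)
qed

section \<open>Lattice packings restricted to a square\<close>

lemma fundamental_parallelogram_eq_image:
  "fundamental_parallelogram u v = coord_map u v ` halfopen_square 1"
proof (intro equalityI subsetI)
  fix x assume "x \<in> fundamental_parallelogram u v"
  then obtain s t where "x = s *\<^sub>R u + t *\<^sub>R v" "s \<in> {0..<1}" "t \<in> {0..<1}"
    by (auto simp: fundamental_parallelogram_def)
  then have "x = coord_map u v (vector [s, t])" "vector [s, t] \<in> halfopen_square 1"
    by (auto simp: coord_map_def halfopen_square_def forall_2)
  then show "x \<in> coord_map u v ` halfopen_square 1" by blast
qed (auto simp: fundamental_parallelogram_def coord_map_def halfopen_square_def)

lemma bounded_halfopen_square: "bounded (halfopen_square l)"
  by (rule bounded_subset[OF bounded_cbox[of 0 "vec l"]])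
    (auto simp: halfopen_square_def mem_box_cart less_imp_le)

lemma lmeasurable_fundamental_parallelogram: "fundamental_parallelogram u v \<in> lmeasurable"
  unfolding fundamental_parallelogram_eq_image
  by (rule measurable_linear_image[OF linear_coord_map lmeasurable_halfopen_unit_square])

lemma bounded_fundamental_parallelogram: "bounded (fundamental_parallelogram u v)"
  unfolding fundamental_parallelogram_eq_image
  by (intro bounded_linear_image bounded_halfopen_square)
    (simp add: linear_coord_map linear_conv_bounded_linear[symmetric])

lemma lattice_det_pos:
  assumes "lattice_basis u v \<Lambda>"
  shows "0 < lattice_det \<Lambda>"
proof -
  have "cross2 u v \<noteq> 0" using assms independent_pair_iff_cross2 by (auto simp: lattice_basis_def)
  then show ?thesis
    unfolding lattice_det_eq[OF assms] measure_fundamental_parallelogram by (simp add: cross2_def)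
qed

lemma lattice_translates_cover:
  assumes "lattice_basis u v \<Lambda>"
  obtains w where "w \<in> \<Lambda>" and "x - w \<in> fundamental_parallelogram u v"
proof -
  have "cross2 u v \<noteq> 0" using assms independent_pair_iff_cross2 by (auto simp: lattice_basis_def)
  then obtain q where q: "x = coord_map u v q" using bij_is_surj[OF bij_coord_map] by (metis surjD)
  define w where "w = of_int \<lfloor>q$1\<rfloor> *\<^sub>R u + of_int \<lfloor>q$2\<rfloor> *\<^sub>R v"
  have "w \<in> \<Lambda>" using assms by (auto simp: w_def lattice_basis_def)
  moreover have "x - w = frac (q$1) *\<^sub>R u + frac (q$2) *\<^sub>R v"
    by (simp add: q w_def coord_map_def frac_def algebra_simps)
  then have "x - w \<in> fundamental_parallelogram u v"
    unfolding fundamental_parallelogram_def using frac_ge_0 frac_lt_1 by force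
  ultimately show ?thesis by (rule that)
qed

lemma convex_halfopen_square: "convex (halfopen_square l)"
proof -
  have "halfopen_square l = {x. \<forall>i. 0 \<le> x$i} \<inter> {x. \<forall>i. x$i < l}"
    by (auto simp: halfopen_square_def)
  moreover have "convex {x :: real^2. \<forall>i. 0 \<le> x$i}"
    by (auto simp: convex_def)
  moreover have "convex {x :: real^2. \<forall>i. x$i < l}"
    by (auto simp: convex_def intro: convex_bound_lt)
  ultimately show ?thesis by (simp add: convex_Int)
qed

text \<open>The fundamental parallelograms at the lattice points cover the plane. If one of them meets a point at
  distance more than \<open>c\<close> from the boundary of the square, then the translate of \<open>S\<close> by the same
  lattice vector is inside the square. So the parallelograms of the admissible vectors cover a square of
  side \<open>l - 2c\<close>, and comparing areas gives the count.\<close>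

lemma many_lattice_translates_in_square:
  assumes S: "bounded S" and basis: "lattice_basis u v \<Lambda>"
  obtains c where "0 \<le> c"
    and "\<And>l. 2 * c < l \<Longrightarrow> \<exists>F \<subseteq> \<Lambda>. finite F \<and> (\<forall>w\<in>F. (+) w ` S \<subseteq> halfopen_square l) \<and>
            (l - 2 * c)\<^sup>2 \<le> real (card F) * lattice_det \<Lambda>"
proof -
  define P where "P = fundamental_parallelogram u v"
  have det: "lattice_det \<Lambda> = measure lebesgue P" unfolding P_def by (rule lattice_det_eq[OF basis])
  have det_pos: "0 < lattice_det \<Lambda>" by (rule lattice_det_pos[OF basis])
  obtain s where s: "\<And>x. x \<in> S \<Longrightarrow> norm x \<le> s" using S by (auto simp: bounded_iff)
  obtain p where p: "\<And>x. x \<in> P \<Longrightarrow> norm x \<le> p"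
    using bounded_fundamental_parallelogram[of u v] by (auto simp: bounded_iff P_def)
  define c where "c = max 0 s + max 0 p"
  have "0 \<le> c" by (simp add: c_def)
  then show ?thesis
  proof (rule that)
    fix l assume l: "2 * c < l"
    define N where "N = {w \<in> \<Lambda>. (+) w ` S \<subseteq> halfopen_square l}"
    show "\<exists>F \<subseteq> \<Lambda>. finite F \<and> (\<forall>w\<in>F. (+) w ` S \<subseteq> halfopen_square l) \<and>
            (l - 2 * c)\<^sup>2 \<le> real (card F) * lattice_det \<Lambda>"
    \<comment> \<open>An infinite \<open>N\<close> has finite subsets of every size, so that discreteness of the lattice need not
      be invoked.\<close>
    proof (cases "finite N")
      case False
      obtain m :: nat where "(l - 2 * c)\<^sup>2 / lattice_det \<Lambda> \<le> real m" by (rule real_arch_simple[THEN exE])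
      moreover obtain F where "F \<subseteq> N" "finite F" "card F = m"
        using infinite_arbitrarily_large[OF False] by blast
      ultimately show ?thesis using det_pos
        by (intro exI[of _ F]) (auto simp: N_def pos_divide_le_eq)
    next
      case True
      have "box (vec c) (vec (l - c)) \<subseteq> (\<Union>w\<in>N. (+) w ` P)"
      proof
        fix x :: "real^2" assume x: "x \<in> box (vec c) (vec (l - c))"
        obtain w where w: "w \<in> \<Lambda>" "x - w \<in> P"
          unfolding P_def by (rule lattice_translates_cover[OF basis])
        have "w + y \<in> halfopen_square l" if "y \<in> S" for y
        proof -
          have "\<bar>(x - w)$i\<bar> + \<bar>y$i\<bar> \<le> c" for i
            using component_le_norm_cart[of "x - w" i] component_le_norm_cart[of y i] p[OF w(2)] s[OF that]
            by (simp add: c_def)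
          moreover have "c < x$i \<and> x$i < l - c" for i using x by (simp add: mem_box_cart)
          ultimately have "0 \<le> (w + y)$i \<and> (w + y)$i < l" for i
            by (smt (verit) vector_add_component vector_minus_component)
          then show ?thesis by (simp add: halfopen_square_def)
        qed
        then have "w \<in> N" using w by (auto simp: N_def)
        moreover have "x \<in> (+) w ` P" using w by (intro image_eqI[of _ _ "x - w"]) auto
        ultimately show "x \<in> (\<Union>w\<in>N. (+) w ` P)" by blast
      qed
      moreover have P: "(+) w ` P \<in> lmeasurable" for w
        unfolding P_def by (intro measurable_translation lmeasurable_fundamental_parallelogram)
      ultimately have "measure lebesgue (box (vec c) (vec (l - c)) :: (real^2) set)
          \<le> measure lebesgue (\<Union>w\<in>N. (+) w ` P)"
        using True by (intro measure_mono_fmeasurable fmeasurable.finite_UN) auto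
      also have "\<dots> \<le> (\<Sum>w\<in>N. measure lebesgue ((+) w ` P))"
        using True P by (intro measure_UNION_le) (auto simp: fmeasurableD)
      also have "\<dots> = real (card N) * lattice_det \<Lambda>" by (simp add: measure_translation det)
      finally have "measure lebesgue (box (vec c) (vec (l - c)) :: (real^2) set) \<le> real (card N) * lattice_det \<Lambda>" .
      moreover have "measure lebesgue (box (vec c) (vec (l - c)) :: (real^2) set) = (l - 2 * c)\<^sup>2"
      proof -
        have "measure lborel (box (vec c) (vec (l - c)) :: (real^2) set) = measure lborel (cbox (vec c) (vec (l - c)) :: (real^2) set)"
          by (simp add: measure_lborel_box_eq measure_lborel_cbox_eq)
        then show ?thesis using l
          by (simp add: content_cbox_if_cart interval_eq_empty_cart power2_eq_square not_less)
      qed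
      ultimately show ?thesis using True
        by (intro exI[of _ N]) (auto simp: N_def)
    qed
  qed
qed

lemma lattice_packing_density_le_translative:
  "lattice_packing_density k S \<le> translative_packing_density k S"
  unfolding lattice_packing_density_def
proof (rule Sup_least, clarify)
  fix \<Lambda> assume packing: "kfold_lattice_packing k UNIV S \<Lambda>"
  then obtain u v where basis: "lattice_basis u v \<Lambda>"
    unfolding kfold_lattice_packing_def is_lattice_def by blast
  from packing have S: "bounded S" "S \<in> sets lebesgue"
    and pack: "finite {w \<in> \<Lambda>. x \<in> interior ((+) w ` S)} \<and> card {w \<in> \<Lambda>. x \<in> interior ((+) w ` S)} \<le> k" for x
    by (simp_all add: kfold_lattice_packing_def kfold_translative_packing_def kfold_packing_def)
  obtain c where "0 \<le> c" and many: "\<And>l. 2 * c < l \<Longrightarrow> \<exists>F \<subseteq> \<Lambda>. finite F \<and> (\<forall>w\<in>F. (+) w ` S \<subseteq> halfopen_square l) \<and>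
            (l - 2 * c)\<^sup>2 \<le> real (card F) * lattice_det \<Lambda>"
    using many_lattice_translates_in_square[OF S(1) basis] by blast
  have det_pos: "0 < lattice_det \<Lambda>" by (rule lattice_det_pos[OF basis])
  define \<delta> where "\<delta> = measure lebesgue S / lattice_det \<Lambda>"
  have le: "ereal (\<delta> * (1 - 2 * c / l)\<^sup>2) \<le> ereal_of_enat (max_packing_number S k l) * ereal (measure lebesgue S)
      / ereal (measure lebesgue (halfopen_square l))" if l: "2 * c < l" for l
  proof -
    obtain F where F: "F \<subseteq> \<Lambda>" "finite F" "\<And>w. w \<in> F \<Longrightarrow> (+) w ` S \<subseteq> halfopen_square l"
      and card_F: "(l - 2 * c)\<^sup>2 \<le> real (card F) * lattice_det \<Lambda>"
      using many[OF l] by blast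
    obtain t where t: "bij_betw t {..<card F} F"
      using ex_bij_betw_nat_finite[OF F(2)] by (auto simp: atLeast0LessThan)
    have "kfold_translative_packing k (halfopen_square l) S {..<card F} t"
      unfolding kfold_translative_packing_def kfold_packing_def
    proof (intro conjI ballI)
      show "connected (halfopen_square l)" by (intro convex_connected convex_halfopen_square)
      show "(\<Union>i<card F. (+) (t i) ` S) \<subseteq> halfopen_square l"
        using F(3) bij_betwE[OF t] by blast
      fix x
      have "inj_on t {i \<in> {..<card F}. x \<in> interior ((+) (t i) ` S)}"
        using t by (auto simp: bij_betw_def intro: inj_on_subset)
      then have "card {i \<in> {..<card F}. x \<in> interior ((+) (t i) ` S)} \<le> card {w \<in> \<Lambda>. x \<in> interior ((+) w ` S)}"
        by (rule card_inj_on_le) (use bij_betwE[OF t] F(1) pack in auto)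
      then show "card {i \<in> {..<card F}. x \<in> interior ((+) (t i) ` S)} \<le> k"
        using pack[of x] by linarith
    qed (use S bounded_translation in auto)
    then have "enat (card F) \<le> max_packing_number S k l"
      unfolding max_packing_number_def by (intro Sup_upper) blast
    then have "ereal (real (card F)) \<le> ereal_of_enat (max_packing_number S k l)"
      using ereal_of_enat_le_iff[of "enat (card F)"] by simp
    then have "ereal (real (card F)) * ereal (measure lebesgue S) / ereal (measure lebesgue (halfopen_square l))
        \<le> ereal_of_enat (max_packing_number S k l) * ereal (measure lebesgue S) / ereal (measure lebesgue (halfopen_square l))"
      using l \<open>0 \<le> c\<close> by (intro ereal_divide_right_mono ereal_mult_right_mono) (auto simp: measure_halfopen_square)
    moreover have "\<delta> * (1 - 2 * c / l)\<^sup>2 \<le> real (card F) * measure lebesgue S / l\<^sup>2"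
    proof -
      have "(l - 2 * c)\<^sup>2 * (measure lebesgue S / lattice_det \<Lambda>) \<le> (real (card F) * lattice_det \<Lambda>) * (measure lebesgue S / lattice_det \<Lambda>)"
        using card_F det_pos by (intro mult_right_mono) auto
      then have "\<delta> * (l - 2 * c)\<^sup>2 \<le> real (card F) * measure lebesgue S"
        using det_pos by (simp add: \<delta>_def mult.commute)
      then have "\<delta> * (l - 2 * c)\<^sup>2 / l\<^sup>2 \<le> real (card F) * measure lebesgue S / l\<^sup>2"
        by (rule divide_right_mono) simp
      moreover have "\<delta> * (l - 2 * c)\<^sup>2 / l\<^sup>2 = \<delta> * (1 - 2 * c / l)\<^sup>2"
        using l \<open>0 \<le> c\<close> by (simp add: field_simps power2_eq_square)
      ultimately show ?thesis by simp
    qed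
    ultimately show ?thesis using l \<open>0 \<le> c\<close>
      by (auto simp: measure_halfopen_square intro: order.trans[rotated])
  qed
  have "ereal \<delta> = Limsup at_top (\<lambda>l. ereal (\<delta> * (1 - 2 * c / l)\<^sup>2))"
  proof (rule lim_imp_Limsup[symmetric])
    have "((\<lambda>l. \<delta> * (1 - 2 * c / l)\<^sup>2) \<longlongrightarrow> \<delta> * (1 - 0)\<^sup>2) at_top"
      by (intro tendsto_intros tendsto_divide_0[OF tendsto_const] filterlim_at_top_imp_at_infinity filterlim_ident)
    then show "((\<lambda>l. ereal (\<delta> * (1 - 2 * c / l)\<^sup>2)) \<longlongrightarrow> ereal \<delta>) at_top" by simp
  qed simp
  also have "\<dots> \<le> translative_packing_density k S"
    unfolding translative_packing_density_def
    by (intro Limsup_mono eventually_mono[OF eventually_gt_at_top[of "2 * c"]] le)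
  finally show "ereal (measure lebesgue S / lattice_det \<Lambda>) \<le> translative_packing_density k S"
    by (simp add: \<delta>_def)
qed

section \<open>A lattice packing of the optimal density\<close>

text \<open>Count down from the largest integers \<open>X < P\<close> and \<open>Y < Q\<close>: with \<open>i = X - A\<close> and \<open>j = Y - B\<close> the
  inequalities imply \<open>i, j \<ge> 0\<close> and \<open>i + j \<le> 2k - 1\<close>, and \<open>i - j\<close> is fixed modulo \<open>2k + 1\<close>.
  There are at most two possible values of \<open>i - j\<close>, one of them nonnegative and one negative. Mapping
  \<open>(i, j)\<close> to \<open>j\<close> in the first case and to \<open>k - 1 - i\<close> in the second is injective into
  \<open>{0..<k}\<close>: if a pair \<open>(i, j)\<close> of the first kind and a pair \<open>(i', j')\<close> of the second had the same image,
  then \<open>j + i' = k - 1\<close> and, as the two differences differ by \<open>2k + 1\<close>, also \<open>i + j' = 3k\<close>; but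
  \<open>i + j + i' + j' \<le> 4k - 2\<close>.\<close>

lemma lattice_points_in_reflected_triangle:
  fixes P Q :: real and k :: nat
  assumes k: "1 \<le> k"
  defines "W \<equiv> {(A :: int, B :: int). (2 * int k + 1) dvd (A - B) \<and>
    of_int A < P \<and> of_int B < Q \<and> P + Q < of_int A + of_int B + 2 * real k}"
  shows "finite W \<and> card W \<le> k"
proof -
  define X where "X = \<lceil>P\<rceil> - 1"
  define Y where "Y = \<lceil>Q\<rceil> - 1"
  have XY: "of_int X < P" "of_int Y < Q" by (simp_all add: X_def Y_def) linarith+
  have W: "A \<le> X \<and> B \<le> Y \<and> X + Y - A - B \<le> 2 * int k - 1 \<and> (2 * int k + 1) dvd (A - B)"
    if "(A, B) \<in> W" for A B
  proof -
    have "A \<le> X" "B \<le> Y" using that by (auto simp: W_def X_def Y_def) linarith+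
    moreover have "real_of_int (X + Y - A - B) < of_int (2 * int k)"
      using that XY by (auto simp: W_def)
    then have "X + Y - A - B < 2 * int k" by (simp only: of_int_less_iff)
    ultimately show ?thesis using that by (auto simp: W_def)
  qed
  define \<phi> where "\<phi> = (\<lambda>(A, B). if X - A \<ge> Y - B then Y - B else int k - 1 - (X - A))"
  have same_class: "a = b"
    if "(2 * int k + 1) dvd a" "(2 * int k + 1) dvd b" "\<bar>a - b\<bar> < 2 * int k + 1" for a b
  proof (rule ccontr)
    assume "a \<noteq> b"
    then have "\<bar>2 * int k + 1\<bar> \<le> \<bar>a - b\<bar>"
      using that by (intro dvd_imp_le_int dvd_diff) auto
    then show False using that by linarith
  qed
  have mixed: False if AB: "(A, B) \<in> W" "(A', B') \<in> W" "\<phi> (A, B) = \<phi> (A', B')"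
    and order: "X - A \<ge> Y - B" "X - A' < Y - B'" for A B A' B'
  proof -
    note W = W[OF AB(1)] W[OF AB(2)]
    have eq: "Y - B = int k - 1 - (X - A')" using AB(3) order by (simp add: \<phi>_def)
    have "A - B + (2 * int k + 1) = A' - B'"
      by (rule same_class) (use W order in \<open>auto intro: dvd_add\<close>)
    then show False using eq W by linarith
  qed
  have "inj_on \<phi> W"
  proof (rule inj_onI, clarify)
    fix A B A' B' assume AB: "(A, B) \<in> W" "(A', B') \<in> W" "\<phi> (A, B) = \<phi> (A', B')"
    note W = W[OF AB(1)] W[OF AB(2)]
    consider "X - A \<ge> Y - B" "X - A' \<ge> Y - B'" | "X - A < Y - B" "X - A' < Y - B'"
      | "X - A \<ge> Y - B" "X - A' < Y - B'" | "X - A' \<ge> Y - B'" "X - A < Y - B" by linarith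
    then show "A = A' \<and> B = B'"
    proof cases
      case 1
      then have "B = B'" using AB(3) by (simp add: \<phi>_def)
      moreover have "A - B = A' - B'"
        by (rule same_class) (use 1 W \<open>B = B'\<close> in auto)
      ultimately show ?thesis by simp
    next
      case 2
      then have "A = A'" using AB(3) by (simp add: \<phi>_def)
      moreover have "A - B = A' - B'"
        by (rule same_class) (use 2 W \<open>A = A'\<close> in auto)
      ultimately show ?thesis by simp
    qed (use mixed AB in metis)+
  qed
  moreover have "\<phi> ` W \<subseteq> {0..<int k}"
    using W k by (fastforce simp: \<phi>_def)
  ultimately show ?thesis
    using card_inj_on_le[of \<phi> W "{0..<int k}"] inj_on_finite[of \<phi> W "{0..<int k}"] by simp
qed

text \<open>In coordinates, the vectors \<open>x\<close> and \<open>y\<close> generate the lattice of all \<open>(A, B)/(2k)\<close> with \<open>A - B\<close> divisible by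
  \<open>2k + 1\<close>. Its determinant is \<open>(2k+1)/(4k\<^sup>2)\<close>, whereas the triangle has area \<open>1/2\<close>.\<close>

lemma lattice_packing_density_ge:
  assumes T: "is_triangle T" and k: "1 \<le> k"
  shows "ereal (2 * (real k)\<^sup>2 / (2 * real k + 1)) \<le> lattice_packing_density k T"
proof -
  obtain a e f where ef: "cross2 e f \<noteq> 0" and T_eq: "T = (\<lambda>z. a + coord_map e f z) ` right_triangle 0 1"
    and area: "measure lebesgue T = \<bar>cross2 e f\<bar> / 2"
    by (rule triangle_in_coordinates[OF T])
  let ?L = "coord_map e f"
  have k_pos: "0 < real k" using k by simp
  define x y :: "real^2" where "x = vector [1 / (2 * real k), 1 / (2 * real k)]"
    and "y = vector [(2 * real k + 1) / (2 * real k), 0]"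
  define \<Lambda> where "\<Lambda> = {of_int b *\<^sub>R ?L x + of_int m *\<^sub>R ?L y | b m. True}"
  have "cross2 x y = - ((2 * real k + 1) / (4 * (real k)\<^sup>2))"
    by (simp add: cross2_def x_def y_def power2_eq_square)
  then have cross: "cross2 (?L x) (?L y) = - cross2 e f * ((2 * real k + 1) / (4 * (real k)\<^sup>2))"
    unfolding cross2_coord_map by simp
  then have "cross2 (?L x) (?L y) \<noteq> 0"
    using ef k_pos by (simp add: add_nonneg_eq_0_iff)
  then have basis: "lattice_basis (?L x) (?L y) \<Lambda>"
    using independent_pair_iff_cross2 by (auto simp: lattice_basis_def \<Lambda>_def)
  have det: "lattice_det \<Lambda> = \<bar>cross2 e f\<bar> * ((2 * real k + 1) / (4 * (real k)\<^sup>2))"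
    unfolding lattice_det_eq[OF basis] measure_fundamental_parallelogram cross2_def[symmetric] cross
    by (simp add: abs_mult)
  have "compact T"
  proof -
    have "compact (convex hull {a', b', c'})" for a' b' c' :: "real^2"
      by (intro compact_convex_hull finite_imp_compact) simp
    then show ?thesis using T unfolding is_triangle_def by metis
  qed
  then have T_meas: "bounded T" "T \<in> sets lebesgue"
    by (auto intro: compact_imp_bounded fmeasurableD lmeasurable_compact)
  define pt where "pt = (\<lambda>(A :: int, B :: int). ?L (vector [of_int A / (2 * real k), of_int B / (2 * real k)]))"
  have count: "finite {w \<in> \<Lambda>. v \<in> interior ((+) w ` T)} \<and> card {w \<in> \<Lambda>. v \<in> interior ((+) w ` T)} \<le> k" for v
  proof -
    obtain p where p: "v - a = ?L p" using bij_is_surj[OF bij_coord_map[OF ef]] by (rule surjE)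
    then have v: "v = a + ?L p" by (simp add: algebra_simps)
    define W where "W = {(A :: int, B :: int). (2 * int k + 1) dvd (A - B) \<and>
      of_int A < 2 * real k * p$1 \<and> of_int B < 2 * real k * p$2 \<and>
      2 * real k * p$1 + 2 * real k * p$2 < of_int A + of_int B + 2 * real k}"
    have W: "finite W \<and> card W \<le> k"
      unfolding W_def by (rule lattice_points_in_reflected_triangle[OF k])
    have "{w \<in> \<Lambda>. v \<in> interior ((+) w ` T)} \<subseteq> pt ` W"
    proof clarify
      fix w assume "w \<in> \<Lambda>" and w: "v \<in> interior ((+) w ` T)"
      then obtain b m :: int where "w = of_int b *\<^sub>R ?L x + of_int m *\<^sub>R ?L y"
        by (auto simp: \<Lambda>_def)
      moreover define A where "A = b + (2 * int k + 1) * m"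
      ultimately have w_eq: "w = ?L (vector [of_int A / (2 * real k), of_int b / (2 * real k)])"
        by (simp add: coord_map_def x_def y_def algebra_simps add_divide_distrib)
      have "v \<in> interior ((+) w ` T) \<longleftrightarrow> of_int A / (2 * real k) < p$1 \<and> of_int b / (2 * real k) < p$2 \<and>
          p$1 + p$2 < of_int A / (2 * real k) + of_int b / (2 * real k) + 1"
        unfolding w_eq v T_eq mem_interior_translated_triangle[OF ef] by simp
      moreover have "(2 * int k + 1) dvd (A - b)" by (simp add: A_def)
      ultimately have "(A, b) \<in> W"
        using w k_pos by (simp add: W_def field_simps)
      then show "w \<in> pt ` W" by (force simp: pt_def w_eq)
    qed
    then have "finite {w \<in> \<Lambda>. v \<in> interior ((+) w ` T)}" "card {w \<in> \<Lambda>. v \<in> interior ((+) w ` T)} \<le> card (pt ` W)"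
      using W by (auto intro: finite_subset card_mono)
    then show ?thesis using W card_image_le[of W pt] by simp
  qed
  have "kfold_lattice_packing k UNIV T \<Lambda>"
    unfolding kfold_lattice_packing_def kfold_translative_packing_def kfold_packing_def is_lattice_def
    using basis T_meas count bounded_translation[OF T_meas(1)] by (auto simp: connected_UNIV)
  then have "ereal (measure lebesgue T / lattice_det \<Lambda>) \<le> lattice_packing_density k T"
    unfolding lattice_packing_density_def by (intro Sup_upper) blast
  moreover have "(d / 2) / (d * (s / (4 * q\<^sup>2))) = 2 * q\<^sup>2 / s" if "0 < d" "0 < s" "0 < q" for d s q :: real
    using that by (simp add: field_simps power2_eq_square)
  then have "measure lebesgue T / lattice_det \<Lambda> = 2 * (real k)\<^sup>2 / (2 * real k + 1)"
    unfolding area det using ef k_pos by simp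
  ultimately show ?thesis by simp
qed

theorem theorem1p1:
  fixes T :: "(real^2) set" and k :: nat
  assumes "is_triangle T" and "k \<ge> 1"
  shows "translative_packing_density k T = lattice_packing_density k T \<and>
         lattice_packing_density k T = ereal (2 * (real k)\<^sup>2 / (2 * real k + 1))"
proof -
  note lower = lattice_packing_density_ge[OF assms]
  note middle = lattice_packing_density_le_translative[of k T]
  note upper = translative_packing_density_le[OF assms]
  show ?thesis
    using lower middle upper by (metis order.antisym order.trans)
qed

end
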